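(* For all $m,n\in\mathbb{N}$, $$K(1,m,n)=\begin{cases}+\infty, & \text{if } n\leq 2+m+\sqrt{4m+1},\\[4pt] \left\lfloor \tfrac{1}{2}\left(n-m-\sqrt{n^{2}+m^{2}-4n-2mn+4}\right)\right\rfloor+1, & \text{if } n>2+m+\sqrt{4m+1}.\end{cases}$$
   Context: $\mathbb{N}=\{1,2,3,\dots\}$ and $\mathbb{N}_0=\mathbb{N}\cup\{0\}$. Graphs are finite, simple and undirected. For a graph $G$ and $A\subseteq V(G)$, $N(A)$ denotes the set of all neighbors of vertices in $A$, and $N_0(A)=N(A)\cup A$. $G-A$ denotes the graph obtained from $G$ by deleting all vertices in $A$ together with their incident edges. A component is a (nonempty) connected component; the graph with no vertices has no components. For $k\in\mathbb{N}$, a vertex $k$-multicoloring of $G$ is a function $\kappa:V(G)\to\mathcal{P}(\{1,\dots,k\})$ (each vertex receives a set of colors, possibly empty). Let $a,m\in\mathbb{N}_0$. A vertex $k$-multicoloring $\kappa$ of $G$ is $(a,m)$-resistant if for all subsets $A,M\subseteq V(G)$ with $|A|=a$ and $|M|\le m$ there exists a component $H$ of the graph $G-(N_0(A)\cup M)$ such that $\bigcup_{u\in V(H)}\kappa(u)=\{1,\dots,k\}$. It is highly $(a,m)$-resistant if, in addition, the $a$-HR condition holds: $\bigcup_{u\in A}\kappa(u)\neq\{1,\dots,k\}$ for every $A\subseteq V(G)$ with $|A|=a$. $K(a,m,n)$ denotes the minimal $k\in\mathbb{N}$ such that there exists a graph $G$ with $n$ vertices that has a highly $(a,m)$-resistant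 vertex $k$-multicoloring; if no such graph exists for any $k$, then $K(a,m,n)=+\infty$. *)

theory Defs
  imports Complex_Main "HOL-Library.Extended_Nat" "Graph_Theory.Graph_Theory"
begin

text \<open>
  Following Graph\_Theory, a finite simple undirected graph is a finite, loop-free, symmetric
  digraph without parallel arcs. Its connected components are then its strongly connected
  components, which are nonempty by definition (\<^const>\<open>strongly_connected\<close>).
\<close>

definition neighbors :: "('a, 'b) pre_digraph \<Rightarrow> 'a set \<Rightarrow> 'a set" where
  "neighbors G A = {v. \<exists>u\<in>A. u \<rightarrow>\<^bsub>G\<^esub> v}"

definition closed_neighbors :: "('a, 'b) pre_digraph \<Rightarrow> 'a set \<Rightarrow> 'a set" where
  "closed_neighbors G A = neighbors G A \<union> A"

definition delete_verts :: "('a, 'b) pre_digraph \<Rightarrow> 'a set \<Rightarrow> ('a, 'b) pre_digraph" where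
  "delete_verts G A = G \<restriction> (verts G - A)"

definition multicoloring :: "nat \<Rightarrow> ('a, 'b) pre_digraph \<Rightarrow> ('a \<Rightarrow> nat set) \<Rightarrow> bool" where
  "multicoloring k G \<kappa> \<longleftrightarrow> (\<forall>v\<in>verts G. \<kappa> v \<subseteq> {1..k})"

definition resistant ::
  "nat \<Rightarrow> nat \<Rightarrow> nat \<Rightarrow> ('a, 'b) pre_digraph \<Rightarrow> ('a \<Rightarrow> nat set) \<Rightarrow> bool" where
  "resistant a m k G \<kappa> \<longleftrightarrow>
    (\<forall>A M. A \<subseteq> verts G \<and> M \<subseteq> verts G \<and> card A = a \<and> card M \<le> m \<longrightarrow>
      (\<exists>H \<in> pre_digraph.sccs (delete_verts G (closed_neighbors G A \<union> M)).
        (\<Union>u\<in>verts H. \<kappa> u) = {1..k}))"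

definition highly_resistant ::
  "nat \<Rightarrow> nat \<Rightarrow> nat \<Rightarrow> ('a, 'b) pre_digraph \<Rightarrow> ('a \<Rightarrow> nat set) \<Rightarrow> bool" where
  "highly_resistant a m k G \<kappa> \<longleftrightarrow>
    resistant a m k G \<kappa> \<and>
    (\<forall>A. A \<subseteq> verts G \<and> card A = a \<longrightarrow> (\<Union>u\<in>A. \<kappa> u) \<noteq> {1..k})"

text \<open>
  Vertices are taken to be natural numbers; as the graphs are finite, this loses no generality
  up to isomorphism.
\<close>

definition has_highly_resistant_graph :: "nat \<Rightarrow> nat \<Rightarrow> nat \<Rightarrow> nat \<Rightarrow> bool" where
  "has_highly_resistant_graph a m n k \<longleftrightarrow>
    (\<exists>(G :: nat pair_pre_digraph) \<kappa>.
      pair_graph G \<and> card (pverts G) = n \<and>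
      multicoloring k (with_proj G) \<kappa> \<and> highly_resistant a m k (with_proj G) \<kappa>)"

definition K_min :: "nat \<Rightarrow> nat \<Rightarrow> nat \<Rightarrow> enat" where
  "K_min a m n =
    (if \<exists>k\<ge>1. has_highly_resistant_graph a m n k
     then enat (LEAST k. k \<ge> 1 \<and> has_highly_resistant_graph a m n k)
     else \<infinity>)"

end

theory Submission
  imports Defs
begin

text \<open>
  Giving each vertex v a missing color c(v), a component fails to carry all colors as soon as c is
  constant on it, so only edges joining different values of c (bichromatic edges) help. Let v have
  maximal bichromatic degree d. The vertices that are not bichromatic neighbors of v contain a set I
  without bichromatic edges of size at least (n - 1 - d)/j with j = min(k, d + 1), chosen greedily
  if j = d + 1 and as a class of c if j = k. Deleting everything outside I together with N[v] leaves
  only deficient components, so this must cost more than m vertices, which yields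
  j(n - m - j) \<ge> n. Conversely, if k(n - m - k) \<ge> n, then splitting the vertices into cliques of
  size at most k, each of whose vertices misses a different color, is highly resistant. Hence
  K(1,m,n) is the least k with k(n - m - k) \<ge> n, the smallest integer strictly between the roots of
  x(n - m - x) = n - 1, if there is one.
\<close>

section \<open>Sets without bichromatic edges\<close>

text \<open>Keep any vertex, discard its at most \<open>d\<close> neighbors under \<open>R\<close>
  and recurse on the rest: each kept vertex uses up at most \<open>Suc d\<close> elements of
  \<open>W\<close>.\<close>

lemma greedy_independent_set:
  assumes "finite W" and "symp R" and "\<And>v. \<not> R v v"
    and "\<And>v. v \<in> W \<Longrightarrow> card {u \<in> W. R v u} \<le> d"
  obtains I where "I \<subseteq> W" and "\<forall>u\<in>I. \<forall>v\<in>I. \<not> R u v"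
    and "card W \<le> Suc d * card I"
proof -
  have "\<exists>I\<subseteq>W. (\<forall>u\<in>I. \<forall>v\<in>I. \<not> R u v) \<and> card W \<le> Suc d * card I"
    using assms(1,4)
  proof (induction W rule: finite_psubset_induct)
    case (psubset W)
    show ?case
    proof (cases "W = {}")
      case False
      then obtain v where v: "v \<in> W" by blast
      define N where "N = insert v {u \<in> W. R v u}"
      have N: "N \<subseteq> W" "v \<in> N" "finite N" using v psubset.hyps by (auto simp: N_def)
      have "card N \<le> Suc d"
        using psubset.prems[OF v] psubset.hyps by (simp add: N_def card_insert_if)
      have "card {u \<in> W - N. R w u} \<le> d" if "w \<in> W - N" for w
        using psubset.prems[of w] that psubset.hyps
          card_mono[of "{u \<in> W. R w u}" "{u \<in> W - N. R w u}"] by fastforce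
      then obtain I where I: "I \<subseteq> W - N" "\<forall>u\<in>I. \<forall>w\<in>I. \<not> R u w"
        "card (W - N) \<le> Suc d * card I"
        using psubset.IH[of "W - N"] N by blast
      have "finite I" "v \<notin> I" using I(1) N psubset.hyps finite_subset by blast+
      then have "card (insert v I) = Suc (card I)" by simp
      moreover have "card W = card (W - N) + card N"
        using N psubset.hyps by (metis card_Diff_subset card_mono le_add_diff_inverse2)
      ultimately have "card W \<le> Suc d * card (insert v I)"
        using I(3) \<open>card N \<le> Suc d\<close> by simp
      moreover have "\<forall>u\<in>insert v I. \<forall>w\<in>insert v I. \<not> R u w"
        using I(1,2) assms(2,3) by (auto simp: N_def dest: sympD)
      moreover have "insert v I \<subseteq> W" using I(1) v by blast
      ultimately show ?thesis by (intro exI[of _ "insert v I"] conjI)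
    qed simp
  qed
  then show ?thesis using that by blast
qed

lemma large_color_class:
  assumes "finite W" and "c ` W \<subseteq> {1..k::nat}" and "k \<ge> 1"
  obtains j where "card W \<le> k * card {v \<in> W. c v = j}"
proof -
  obtain j where "\<And>i. i \<in> {1..k} \<Longrightarrow> card {v \<in> W. c v = i} \<le> card {v \<in> W. c v = j}"
    using assms(3) Max_ge[of "(\<lambda>i. card {v \<in> W. c v = i}) ` {1..k}"]
      Max_in[of "(\<lambda>i. card {v \<in> W. c v = i}) ` {1..k}"] by fastforce
  moreover have "card W = (\<Sum>i\<in>{1..k}. card {v \<in> W. c v = i})"
    using sum.group[of W "{1..k}" c "\<lambda>_. 1::nat"] assms(1,2) by simp
  ultimately have "card W \<le> k * card {v \<in> W. c v = j}"
    using sum_bounded_above[of "{1..k}" "\<lambda>i. card {v \<in> W. c v = i}"] by simp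
  then show ?thesis by (rule that)
qed

text \<open>Paths inside \<open>I\<close> never change \<open>c\<close>, so \<open>c\<close> is
  constant on a component, and its value there is a color that no vertex of the component
  carries.\<close>

lemma monochromatic_scc_misses_color:
  assumes "wf_digraph G" and "H \<in> pre_digraph.sccs (G \<restriction> I)"
    and edge: "\<And>u v. u \<in> I \<Longrightarrow> v \<in> I \<Longrightarrow> u \<rightarrow>\<^bsub>G\<^esub> v \<Longrightarrow> c u = c v"
    and "\<And>u. u \<in> I \<Longrightarrow> c u \<in> C - \<kappa> u"
  shows "(\<Union>u\<in>verts H. \<kappa> u) \<noteq> C"
proof -
  interpret wf_digraph "G \<restriction> I"
    using assms(1) by (simp add: wf_digraph.wellformed_induce_subgraph)
  have scc: "verts H \<in> sccs_verts" using assms(2) by (simp add: sccs_verts_conv)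
  then obtain u where u: "u \<in> verts H" by (auto simp: sccs_verts_def)
  have "c v = c u" if "u \<rightarrow>\<^sup>*\<^bsub>G \<restriction> I\<^esub> v" for v
    using that
  proof (induction rule: reachable_induct)
    case (step x y)
    then show ?case
      using edge[of x y] adj_in_verts[of x y] dominates_induce_subgraphD[of x y G I] by simp
  qed simp
  moreover have "u \<rightarrow>\<^sup>*\<^bsub>G \<restriction> I\<^esub> v" if "v \<in> verts H" for v
    using that u scc unfolding sccs_verts_def by blast
  ultimately have "c v = c u" if "v \<in> verts H" for v using that by blast
  moreover have "verts H \<subseteq> I" using sccs_verts_subsets[OF scc] by simp
  ultimately have "c u \<notin> \<kappa> v" if "v \<in> verts H" for v
    using assms(4)[of v] that by auto
  moreover have "c u \<in> C" using assms(4) u \<open>verts H \<subseteq> I\<close> by blast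
  ultimately show ?thesis by blast
qed

section \<open>The lower bound\<close>

text \<open>The conclusion is j (n - m - j) \<ge> n, written without truncated subtraction. Some
  \<open>j\<close> up to \<open>k\<close> is enough, since only the least solution matters in the
  end.\<close>

lemma resistant_imp_quadratic:
  assumes "graph G" and "verts G \<noteq> {}" and "k \<ge> 1"
    and "multicoloring k G \<kappa>" and hr: "highly_resistant 1 m k G \<kappa>"
  obtains j where "1 \<le> j" "j \<le> k" "card (verts G) + j * (m + j) \<le> j * card (verts G)"
proof -
  interpret graph G by fact
  let ?V = "verts G"
  \<comment> \<open>The HR condition for singletons: no vertex carries all colors.\<close>
  have "\<exists>c. c \<in> {1..k} - \<kappa> v" if "v \<in> ?V" for v
  proof -
    have "\<kappa> v \<noteq> {1..k}" using hr[unfolded highly_resistant_def] that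
      by (auto dest!: spec[of _ "{v}"])
    moreover have "\<kappa> v \<subseteq> {1..k}" using assms(4) that by (simp add: multicoloring_def)
    ultimately show ?thesis by blast
  qed
  then obtain c where c: "\<And>v. v \<in> ?V \<Longrightarrow> c v \<in> {1..k} - \<kappa> v" by metis
  define R where "R u v \<longleftrightarrow> u \<rightarrow>\<^bsub>G\<^esub> v \<and> c u \<noteq> c v" for u v
  define deg where "deg v = card {u \<in> ?V. R v u}" for v
  obtain v where v: "v \<in> ?V" and max: "\<And>u. u \<in> ?V \<Longrightarrow> deg u \<le> deg v"
    using Max_ge[of "deg ` ?V"] Max_in[of "deg ` ?V"] assms(2) by fastforce
  \<comment> \<open>\<open>W\<close> retains the neighbors of \<open>v\<close> that share its value
    of \<open>c\<close>. They disappear with the closed neighborhood of \<open>v\<close> anyway, and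
    keeping them makes the size of \<open>W\<close> depend on \<open>deg v\<close> alone.\<close>
  define W where "W = ?V - {u \<in> ?V. R v u} - {v}"
  have W: "W \<subseteq> ?V" "finite W" by (auto simp: W_def)
  have not_self: "\<not> R u u" for u by (simp add: R_def)
  have sizeW: "card ?V = Suc (deg v + card W)"
  proof -
    have "?V = insert v ({u \<in> ?V. R v u} \<union> W)" using v by (auto simp: W_def)
    moreover have "card ({u \<in> ?V. R v u} \<union> W) = deg v + card W"
      unfolding deg_def by (rule card_Un_disjoint) (auto simp: W_def)
    moreover have "v \<notin> {u \<in> ?V. R v u} \<union> W" "finite ({u \<in> ?V. R v u} \<union> W)"
      using not_self W by (auto simp: W_def)
    ultimately show ?thesis by (metis card_insert_disjoint)
  qed
  \<comment> \<open>Otherwise \<open>W - I\<close> is an admissible choice of \<open>M\<close>;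
    deleting it and the closed neighborhood of \<open>v\<close> leaves only vertices of
    \<open>I\<close>, where all edges are monochromatic.\<close>
  have small: "card I + m + 1 \<le> card W"
    if I: "I \<subseteq> W" "\<forall>x\<in>I. \<forall>y\<in>I. \<not> R x y" for I
  proof (rule ccontr)
    assume neg: "\<not> ?thesis"
    define N where "N = closed_neighbors G {v}"
    define M where "M = W - I"
    have "card M \<le> m"
      using neg I(1) W by (simp add: M_def card_Diff_subset finite_subset)
    moreover have "M \<subseteq> ?V" using W by (auto simp: M_def)
    ultimately obtain H where H: "H \<in> pre_digraph.sccs (delete_verts G (N \<union> M))"
      "(\<Union>u\<in>verts H. \<kappa> u) = {1..k}"
      using hr[unfolded highly_resistant_def resistant_def, THEN conjunct1, rule_format, of "{v}" M] v
      unfolding N_def by auto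
    have sub: "?V - (N \<union> M) \<subseteq> I"
      by (auto simp: N_def M_def W_def R_def closed_neighbors_def neighbors_def)
    have "(\<Union>u\<in>verts H. \<kappa> u) \<noteq> {1..k}"
    proof (rule monochromatic_scc_misses_color)
      show "wf_digraph G" by (rule wf_digraph_axioms)
      show "H \<in> pre_digraph.sccs (G \<restriction> (?V - (N \<union> M)))"
        using H(1) by (simp add: delete_verts_def)
      show "c x = c y"
        if "x \<in> ?V - (N \<union> M)" "y \<in> ?V - (N \<union> M)" "x \<rightarrow>\<^bsub>G\<^esub> y" for x y
        using I(2) sub that unfolding R_def by blast
      show "c x \<in> {1..k} - \<kappa> x" if "x \<in> ?V - (N \<union> M)" for x
        using c that by blast
    qed
    then show False using H(2) by simp
  qed
  show ?thesis
  proof (cases "Suc (deg v) \<le> k")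
    case True
    have deg_W: "card {u \<in> W. R w u} \<le> deg v" if "w \<in> W" for w
      using max[of w] that W card_mono[of "{u \<in> ?V. R w u}" "{u \<in> W. R w u}"]
      unfolding deg_def by fastforce
    have "symp R" by (auto intro!: sympI simp: R_def dest: graph_symmetric)
    then obtain I where I: "I \<subseteq> W" "\<forall>x\<in>I. \<forall>y\<in>I. \<not> R x y"
      "card W \<le> Suc (deg v) * card I"
      by (rule greedy_independent_set[OF W(2) _ not_self deg_W])
    \<comment> \<open>With j = \<open>Suc (deg v)\<close>, multiply by j, then use |W| \<le> j |I|
      and |W| + j = n.\<close>
    have "card I + (m + Suc (deg v) + 1) \<le> card ?V" using small[OF I(1,2)] sizeW by simp
    then have "Suc (deg v) * (card I + (m + Suc (deg v) + 1)) \<le> Suc (deg v) * card ?V"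
      by (rule mult_le_mono2)
    then have "card ?V + Suc (deg v) * (m + Suc (deg v)) \<le> Suc (deg v) * card ?V"
      using I(3) sizeW by (simp add: algebra_simps)
    from that[OF _ True this] show ?thesis by simp
  next
    case False
    have "c ` W \<subseteq> {1..k}" using c W(1) by blast
    then obtain j where j: "card W \<le> k * card {u \<in> W. c u = j}"
      by (rule large_color_class[OF W(2) _ assms(3)])
    define I where "I = {u \<in> W. c u = j}"
    have "card I + m + 1 \<le> card W" by (rule small) (auto simp: I_def R_def)
    have "k \<le> deg v" using False by simp
    then obtain t where t: "deg v = k + t" using le_Suc_ex by blast
    have "k * (card I + (m + k + t + 2)) \<le> k * card ?V"
      using \<open>card I + m + 1 \<le> card W\<close> sizeW t by (intro mult_le_mono2) simp
    \<comment> \<open>The surplus \<open>t\<close> of \<open>deg v\<close> over \<open>k\<close>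
      enlarges the vertex count by \<open>t\<close>, which the term \<open>k * t\<close> on the left
      absorbs.\<close>
    moreover have "t \<le> k * t" using assms(3) by simp
    ultimately have "card ?V + k * (m + k) \<le> k * card ?V"
      using j assms(3) unfolding I_def[symmetric] sizeW t distrib_left mult_Suc_right by linarith
    from that[OF assms(3) order_refl this] show ?thesis .
  qed
qed

section \<open>Disjoint cliques\<close>

text \<open>The cliques are blocks of \<open>k\<close> consecutive numbers, the last one possibly
  shorter. The single color missing at a vertex differs within a block, so two survivors of one
  block already carry all colors; the pigeonhole principle supplies them.\<close>

lemma quadratic_imp_has_highly_resistant_graph:
  assumes "k \<ge> 1" and le: "n + k * (m + k) \<le> k * n"
  shows "has_highly_resistant_graph 1 m n k"
proof -
  define E where "E = {(i, j). i < n \<and> j < n \<and> i \<noteq> j \<and> i div k = j div k}"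
  define G where "G = \<lparr>pverts = {..<n}, parcs = E\<rparr>"
  define \<kappa> where "\<kappa> i = {1..k} - {i mod k + 1}" for i
  have "E \<subseteq> {..<n} \<times> {..<n}" by (auto simp: E_def)
  then have "finite E" by (rule finite_subset) simp
  then have graph: "pair_graph G"
    by unfold_locales
      (auto simp: G_def E_def symmetric_def sym_def)
  then interpret pair_graph G .
  have miss: "i mod k + 1 \<in> {1..k}" for i using assms(1) by (simp add: Suc_leI)
  have "resistant 1 m k G \<kappa>"
    unfolding resistant_def
  proof (intro allI impI)
    fix A M assume "A \<subseteq> verts G \<and> M \<subseteq> verts G \<and> card A = 1 \<and> card M \<le> m"
    then obtain v where v: "A = {v}" "v < n" and M: "M \<subseteq> {..<n}" "card M \<le> m"
      by (auto simp: G_def card_1_singleton_iff)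
    define N where "N = closed_neighbors G A"
    define W where "W = {..<n} - (N \<union> M)"
    have N: "N = {i. i < n \<and> i div k = v div k}"
      using v by (auto simp: N_def closed_neighbors_def neighbors_def G_def E_def)
    have "inj_on (\<lambda>i. i mod k) N"
      unfolding N inj_on_def by (metis (mono_tags, lifting) div_mod_decomp mem_Collect_eq)
    moreover have "(\<lambda>i. i mod k) ` N \<subseteq> {..<k}" using assms(1) by auto
    ultimately have "card N \<le> k" using card_inj_on_le[of _ N "{..<k}"] by simp
    have "n \<le> card W + (k + m)"
    proof -
      have "finite M" using M finite_subset by blast
      moreover have "{..<n} \<subseteq> W \<union> (N \<union> M)" "finite N" by (auto simp: W_def N)
      ultimately have "card {..<n} \<le> card (W \<union> (N \<union> M))" by (intro card_mono) (auto simp: W_def)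
      also have "\<dots> \<le> card W + (card N + card M)"
        using card_Un_le[of W "N \<union> M"] card_Un_le[of N M] by linarith
      finally show ?thesis using \<open>card N \<le> k\<close> M(2) by simp
    qed
    then have "k * n \<le> k * card W + k * (m + k)"
      by (metis add.commute distrib_left mult_le_mono2)
    \<comment> \<open>The last block has index \<open>(n - 1) div k\<close>, so this is also the
      number of blocks other than that of \<open>v\<close>; \<open>n div k\<close> would be one too
      many when \<open>k\<close> divides \<open>n\<close>.\<close>
    then have "n - 1 < card W * k" using le v(2) by (simp add: mult.commute)
    then have "(n - 1) div k < card W" by (rule less_mult_imp_div_less)
    moreover have "(\<lambda>i. i div k) ` W \<subseteq> {..(n - 1) div k} - {v div k}"
      by (auto simp: W_def N intro: div_le_mono)
    then have "card ((\<lambda>i. i div k) ` W) \<le> card ({..(n - 1) div k} - {v div k})"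
      by (rule card_mono[rotated]) simp
    moreover have "card ({..(n - 1) div k} - {v div k}) = (n - 1) div k"
      using v(2) by (subst card_Diff_singleton) (auto intro: div_le_mono)
    ultimately have "\<not> inj_on (\<lambda>i. i div k) W" using card_image by fastforce
    then obtain x y where xy: "x \<in> W" "y \<in> W" "x \<noteq> y" "x div k = y div k"
      by (auto simp: inj_on_def)
    define D where "D = delete_verts G (N \<union> M)"
    have D: "D = with_proj G \<restriction> W" by (simp add: D_def delete_verts_def W_def G_def)
    have "W \<subseteq> verts G" by (auto simp: W_def G_def)
    then have "induced_subgraph D G" unfolding D by (simp add: induced_induce)
    then interpret D: sym_digraph D by (rule induced_graph_imp_graph)
    have "((x, y) \<in> parcs G)" using xy by (auto simp: G_def E_def W_def)
    then have "x \<rightarrow>\<^bsub>D\<^esub> y"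
      using xy by (auto simp: D arcs_ends_conv image_iff intro!: bexI[of _ "(x, y)"])
    then have "x \<rightarrow>\<^sup>*\<^bsub>D\<^esub> y" by simp
    \<comment> \<open>As arcs are symmetric, the vertices reachable from \<open>x\<close> form its
      component.\<close>
    define H where "H = D \<restriction> {u. x \<rightarrow>\<^sup>*\<^bsub>D\<^esub> u}"
    have "x \<in> verts D" using xy by (simp add: D)
    then have "H \<in> pre_digraph.sccs D" unfolding H_def by (rule D.induce_reachable_is_in_sccs)
    moreover have "(\<Union>u\<in>verts H. \<kappa> u) = {1..k}"
    proof
      show "(\<Union>u\<in>verts H. \<kappa> u) \<subseteq> {1..k}" by (auto simp: \<kappa>_def)
      have "x \<in> verts H" "y \<in> verts H"
        using \<open>x \<rightarrow>\<^sup>*\<^bsub>D\<^esub> y\<close> \<open>x \<in> verts D\<close> by (auto simp: H_def)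
      moreover have "x mod k \<noteq> y mod k" using xy(3,4) by (metis div_mod_decomp)
      then have "\<kappa> x \<union> \<kappa> y = {1..k}" using miss by (auto simp: \<kappa>_def)
      ultimately show "{1..k} \<subseteq> (\<Union>u\<in>verts H. \<kappa> u)" by blast
    qed
    ultimately show "\<exists>H\<in>pre_digraph.sccs (delete_verts G (closed_neighbors G A \<union> M)).
        (\<Union>u\<in>verts H. \<kappa> u) = {1..k}"
      unfolding D_def N_def by blast
  qed
  moreover have "(\<Union>u\<in>A. \<kappa> u) \<noteq> {1..k}" if "card A = 1" for A
    using that miss by (auto simp: card_1_singleton_iff \<kappa>_def)
  ultimately have "highly_resistant 1 m k G \<kappa>" by (simp add: highly_resistant_def)
  moreover have "multicoloring k G \<kappa>" by (auto simp: multicoloring_def \<kappa>_def)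
  moreover have "card (pverts G) = n" by (simp add: G_def)
  ultimately show ?thesis using graph unfolding has_highly_resistant_graph_def by blast
qed

section \<open>The quadratic inequality\<close>

text \<open>\<open>s\<close> is the root of the discriminant of x (n - m - x) = n - 1. For integers,
  being at least n means exceeding n - 1, hence the strict inequality.\<close>

lemma quadratic_iff_between_roots:
  fixes m n k :: nat
  defines "s \<equiv> sqrt ((real n)^2 + (real m)^2 - 4 * real n - 2 * real m * real n + 4)"
  shows "n + k * (m + k) \<le> k * n \<longleftrightarrow> \<bar>2 * real k - (real n - real m)\<bar> < s"
proof -
  define D where "D = (int n)^2 + (int m)^2 - 4 * int n - 2 * int m * int n + 4"
  have s: "s = sqrt (of_int D)" by (simp add: s_def D_def)
  have "n + k * (m + k) \<le> k * n \<longleftrightarrow> int n + int k * (int m + int k) \<le> int k * int n"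
    by (simp flip: of_nat_mult of_nat_add)
  also have "\<dots> \<longleftrightarrow> (2 * int k - (int n - int m))^2 < D"
    unfolding D_def by (auto simp: power2_eq_square algebra_simps)
  also have "\<dots> \<longleftrightarrow> (2 * real k - (real n - real m))^2 < of_int D"
    by (simp flip: of_int_less_iff[where ?'a = real])
  \<comment> \<open>\<open>sqrt\<close> is odd and strictly increasing on all reals, so a negative
    discriminant needs no separate case.\<close>
  also have "\<dots> \<longleftrightarrow> \<bar>2 * real k - (real n - real m)\<bar> < s"
    unfolding s by (metis real_sqrt_abs real_sqrt_less_iff)
  finally show ?thesis .
qed

text \<open>Completing the square, a solution would give (n - m - 2)^2 \<ge> 4m + 4 with n - m - 2
  nonnegative, beyond the assumed bound on \<open>n\<close>.\<close>

lemma quadratic_infeasible: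
  fixes m n k :: nat
  assumes "real n \<le> 2 + real m + sqrt (4 * real m + 1)" and "k \<ge> 1" and "n \<ge> 1"
  shows "\<not> n + k * (m + k) \<le> k * n"
proof
  assume le: "n + k * (m + k) \<le> k * n"
  then have "k * (m + k) < k * n" using assms(3) by linarith
  then have "m + k < n" by simp
  then have N: "real n - real m - 2 \<ge> 0" using assms(2) by linarith
  have "real n + real k * (real m + real k) \<le> real k * real n"
    using le by (simp flip: of_nat_mult of_nat_add)
  then have "(real n - real m - 2)^2 \<ge> (2 * real k - (real n - real m))^2 + 4 * real m + 4"
    by (simp add: power2_eq_square algebra_simps)
  then have "4 * real m + 1 < (real n - real m - 2)^2"
    using zero_le_power2[of "2 * real k - (real n - real m)"] by linarith
  then have "sqrt (4 * real m + 1) < real n - real m - 2"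
    using N by (intro real_less_lsqrt)
  then show False using assms(1) by simp
qed

text \<open>The roots are \<open>s\<close> apart, and \<open>gt\<close> forces \<open>s > 1\<close>,
  so the first integer above the smaller root still lies below the larger one.\<close>

lemma Least_quadratic:
  fixes m n :: nat
  defines "s \<equiv> sqrt ((real n)^2 + (real m)^2 - 4 * real n - 2 * real m * real n + 4)"
  defines "k0 \<equiv> nat (\<lfloor>(1 / 2) * (real n - real m - s)\<rfloor> + 1)"
  assumes gt: "real n > 2 + real m + sqrt (4 * real m + 1)"
  shows "k0 \<ge> 1" and "n + k0 * (m + k0) \<le> k0 * n"
    and "\<And>k. n + k * (m + k) \<le> k * n \<Longrightarrow> k0 \<le> k"
proof -
  have "sqrt (4 * real m + 1) < real n - real m - 2" using gt by simp
  then have "4 * real m + 1 < (real n - real m - 2)^2"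
    using power_strict_mono[of "sqrt (4 * real m + 1)" _ 2] by simp
  then have "s > 1" unfolding s_def
    by (simp add: power2_eq_square algebra_simps)
  have "sqrt (4 * real m + 1) \<ge> 0" by simp
  then have n2: "real n \<ge> real m + 2" using gt by linarith
  \<comment> \<open>The smaller root is thus nonnegative, and \<open>nat\<close> truncates nothing
    in \<open>k0\<close>.\<close>
  have "s \<le> real n - real m"
    unfolding s_def using n2 by (intro real_le_lsqrt) (auto simp: power2_eq_square algebra_simps)
  define x where "x = (1 / 2) * (real n - real m - s)"
  have "\<lfloor>x\<rfloor> \<ge> 0" using \<open>s \<le> _\<close> by (simp add: x_def)
  then have k0: "int k0 = \<lfloor>x\<rfloor> + 1" by (simp add: k0_def x_def)
  then show "k0 \<ge> 1" using \<open>\<lfloor>x\<rfloor> \<ge> 0\<close> by linarith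
  have "real k0 = of_int \<lfloor>x\<rfloor> + 1" using k0 by (metis of_int_1 of_int_add of_int_of_nat_eq)
  then have "x < real k0" "real k0 \<le> x + 1" by linarith+
  then have "\<bar>2 * real k0 - (real n - real m)\<bar> < s"
    using \<open>s > 1\<close> unfolding x_def by (auto simp: abs_less_iff field_simps)
  then show "n + k0 * (m + k0) \<le> k0 * n"
    unfolding quadratic_iff_between_roots s_def .
  show "k0 \<le> k" if "n + k * (m + k) \<le> k * n" for k
  proof -
    have "\<bar>2 * real k - (real n - real m)\<bar> < s"
      using that unfolding quadratic_iff_between_roots s_def .
    then have "x < real k" unfolding x_def by (auto simp: abs_less_iff field_simps)
    then have "\<lfloor>x\<rfloor> < int k" by (simp add: floor_less_iff)
    then show ?thesis using k0 by linarith
  qed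
qed

theorem theorem3p4:
  fixes m n :: nat
  assumes "m \<ge> 1" and "n \<ge> 1"
  shows "K_min 1 m n =
    (if real n \<le> 2 + real m + sqrt (4 * real m + 1) then \<infinity>
     else enat (nat (\<lfloor>(1 / 2) * (real n - real m -
        sqrt ((real n)^2 + (real m)^2 - 4 * real n - 2 * real m * real n + 4))\<rfloor> + 1)))"
proof -
  have lower: "\<exists>j. 1 \<le> j \<and> j \<le> k \<and> n + j * (m + j) \<le> j * n"
    if k: "k \<ge> 1" "has_highly_resistant_graph 1 m n k" for k
  proof -
    obtain G :: "nat pair_pre_digraph" and \<kappa> where G: "pair_graph G" "card (pverts G) = n"
      "multicoloring k G \<kappa>" "highly_resistant 1 m k G \<kappa>"
      using k(2) unfolding has_highly_resistant_graph_def by blast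
    interpret pair_graph G by fact
    have "pverts G \<noteq> {}" using G(2) assms(2) by auto
    then show ?thesis
      using resistant_imp_quadratic[of "with_proj G" k \<kappa> m] graph_axioms k(1) G by auto
  qed
  show ?thesis
  proof (cases "real n \<le> 2 + real m + sqrt (4 * real m + 1)")
    case True
    then have "\<not> has_highly_resistant_graph 1 m n k" if "k \<ge> 1" for k
      using lower[OF that] quadratic_infeasible[OF True _ assms(2)] by blast
    then show ?thesis using True by (auto simp: K_min_def)
  next
    case False
    define k0 where "k0 = nat (\<lfloor>(1 / 2) * (real n - real m -
      sqrt ((real n)^2 + (real m)^2 - 4 * real n - 2 * real m * real n + 4))\<rfloor> + 1)"
    have k0: "k0 \<ge> 1" "n + k0 * (m + k0) \<le> k0 * n"
      "\<And>k. n + k * (m + k) \<le> k * n \<Longrightarrow> k0 \<le> k"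
      using Least_quadratic[of m n] False unfolding k0_def by auto
    have "has_highly_resistant_graph 1 m n k0"
      using k0(1,2) by (rule quadratic_imp_has_highly_resistant_graph)
    \<comment> \<open>Minimality: by \<open>lower\<close>, any admissible \<open>k\<close> bounds
      some solution j of the inequality from above, and \<open>k0\<close> is at most j.\<close>
    moreover have "(LEAST k. k \<ge> 1 \<and> has_highly_resistant_graph 1 m n k) = k0"
      using calculation k0 lower by (intro Least_equality) (blast intro: order_trans)+
    ultimately show ?thesis using False k0(1) by (auto simp: K_min_def k0_def)
  qed
qed

end
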